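(* Let $G$ be a compact Hausdorff abelian totally disconnected topological group. If $G$ is dense-subgroup-separable, then $G$ is metrizable; thus $G$ is dense-separable.
   Context: A topological group is dense-subgroup-separable if each of its dense subgroups is separable. A space is dense-separable if each of its dense subspaces is separable. *)

theory Defs
  imports "HOL-Analysis.Analysis"
begin

definition totally_disconnected_space :: "'a topology \<Rightarrow> bool" where
  "totally_disconnected_space X \<longleftrightarrow> (\<forall>S. connectedin X S \<longrightarrow> (\<exists>a. S \<subseteq> {a}))"

definition dense_separable :: "'a topology \<Rightarrow> bool" where
  "dense_separable X \<longleftrightarrow>
     (\<forall>S. S \<subseteq> topspace X \<and> X closure_of S = topspace X \<longrightarrow> separable_space (subtopology X S))"

definition additive_subgroup_set :: "'a::group_add set \<Rightarrow> bool" where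
  "additive_subgroup_set H \<longleftrightarrow> 0 \<in> H \<and> (\<forall>x\<in>H. \<forall>y\<in>H. x + y \<in> H) \<and> (\<forall>x\<in>H. - x \<in> H)"

text \<open>The topological group is the whole type, so it is passed as a type argument.\<close>

definition dense_subgroup_separable :: "'a::topological_group_add itself \<Rightarrow> bool" where
  "dense_subgroup_separable G \<longleftrightarrow>
     (\<forall>H :: 'a set. additive_subgroup_set H \<and> closure H = UNIV \<longrightarrow> separable_space (top_of_set H))"

end

theory Submission
  imports Defs
begin

text \<open>
  Write \<open>G\<close> for the group. Total disconnectedness and compactness make the open subgroups a
  neighbourhood base at \<open>0\<close>, so \<open>G\<close> is metrizable as soon as countably many open subgroups
  intersect in \<open>{0}\<close>: the cosets of those subgroups embed \<open>G\<close> into a countable product of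
  discrete spaces. The cosets of their finite intersections form a countable base, so all
  subspaces of \<open>G\<close> are separable as well. The proof never leaves \<open>G\<close>; it is the elementary form of
  the fact that an uncountable abelian torsion group (here the Pontryagin dual of \<open>G\<close>) has an
  uncountable \<open>p\<close>-socle for some prime \<open>p\<close>, that is, an uncountable direct sum of groups of
  order \<open>p\<close>.

  The maximal open subgroups carry a notion of independence: no member of the family contains a
  finite intersection of the others. By compactness each member \<open>M\<close> of an independent family
  \<open>\<I>\<close> misses an element that lies in every other member
  (\<open>independent_complementary_element\<close>). These elements behave like the unit vectors of a product
  indexed by \<open>\<I>\<close>, and the subgroup of elements lying in all but finitely many members of
  \<open>\<I>\<close> is dense (\<open>finitely_supported_dense\<close>). A countable subset of it involves only countably many
  members. If \<open>\<I>\<close> were uncountable, such a subset would lie in some \<open>M \<in> \<I>\<close>, which is closed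
  and proper, so the dense subgroup would not be separable. Hence every independent family is
  countable (\<open>independent_family_countable\<close>).

  An exchange argument shows that for a maximal independent family \<open>\<I>\<close> every maximal open
  subgroup contains \<open>\<Inter>\<I>\<close> (\<open>maximal_independent_family\<close>). For a prime \<open>p\<close> the
  quotient \<open>G/pG\<close> is a vector space over the field with \<open>p\<close> elements, so \<open>pG\<close> is an intersection of
  maximal open subgroups (\<open>maximal_open_subgroup_avoiding\<close>). Thus \<open>pG\<close> contains a countable
  intersection of open subgroups. Multiplication by \<open>n\<close> maps \<open>G/mG\<close> onto \<open>nG/mnG\<close> and transports this
  property, so it passes to \<open>nG\<close> for all \<open>n > 0\<close> by induction over the prime factors. Finally every
  open subgroup contains some \<open>nG\<close>, so the intersection of all \<open>nG\<close> is \<open>{0}\<close>, and countably many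
  open subgroups intersect in \<open>{0}\<close>.
\<close>

section \<open>Subgroups\<close>

lemma subgroup_zero: "additive_subgroup_set H \<Longrightarrow> 0 \<in> H"
  and subgroup_add: "additive_subgroup_set H \<Longrightarrow> x \<in> H \<Longrightarrow> y \<in> H \<Longrightarrow> x + y \<in> H"
  and subgroup_uminus: "additive_subgroup_set H \<Longrightarrow> x \<in> H \<Longrightarrow> - x \<in> H"
  by (auto simp: additive_subgroup_set_def)

lemma subgroup_diff:
  fixes H :: "'a::group_add set"
  shows "additive_subgroup_set H \<Longrightarrow> x \<in> H \<Longrightarrow> y \<in> H \<Longrightarrow> x - y \<in> H"
  using subgroup_add[of H x "- y"] subgroup_uminus[of H y] by simp

lemma subgroup_Inter:
  "(\<And>H. H \<in> \<H> \<Longrightarrow> additive_subgroup_set H) \<Longrightarrow> additive_subgroup_set (\<Inter>\<H>)"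
  by (auto simp: additive_subgroup_set_def)

lemma subgroup_Int:
  "additive_subgroup_set H \<Longrightarrow> additive_subgroup_set K \<Longrightarrow> additive_subgroup_set (H \<inter> K)"
  by (auto simp: additive_subgroup_set_def)

lemma subgroup_plus:
  fixes H :: "'a::ab_group_add set"
  assumes H: "additive_subgroup_set H" and K: "additive_subgroup_set K"
  shows "additive_subgroup_set (H + K)"
  unfolding additive_subgroup_set_def
proof (intro conjI ballI)
  show "0 \<in> H + K"
    using set_plus_intro[OF subgroup_zero[OF H] subgroup_zero[OF K]] by simp
next
  fix x y assume "x \<in> H + K" "y \<in> H + K"
  then obtain a b c d where "x = a + b" "y = c + d" "a \<in> H" "c \<in> H" "b \<in> K" "d \<in> K"
    by (metis set_plus_elim)
  then have "x + y = (a + c) + (b + d)" "a + c \<in> H" "b + d \<in> K"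
    using subgroup_add H K by (auto simp: algebra_simps)
  then show "x + y \<in> H + K" by (metis set_plus_intro)
next
  fix x assume "x \<in> H + K"
  then obtain a b where "x = a + b" "a \<in> H" "b \<in> K"
    by (metis set_plus_elim)
  then have "- x = - a + - b" "- a \<in> H" "- b \<in> K"
    using subgroup_uminus H K by auto
  then show "- x \<in> H + K" by (metis set_plus_intro)
qed

lemma plus_superset:
  fixes H :: "'a::ab_group_add set"
  assumes "additive_subgroup_set H" "additive_subgroup_set K"
  shows "H \<subseteq> H + K" "K \<subseteq> H + K"
  using set_zero_plus2[OF subgroup_zero[OF assms(1)], of K]
    set_zero_plus2[OF subgroup_zero[OF assms(2)], of H] by (auto simp: add.commute)

primrec nmult :: "nat \<Rightarrow> 'a::ab_group_add \<Rightarrow> 'a" where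
  "nmult 0 x = 0"
| "nmult (Suc n) x = x + nmult n x"

lemma nmult_zero [simp]: "nmult n 0 = 0"
  by (induction n) auto

lemma nmult_add: "nmult n (x + y) = nmult n x + nmult n y"
  by (induction n) (auto simp: algebra_simps)

lemma nmult_uminus: "nmult n (- x) = - nmult n x"
  by (induction n) (auto simp: algebra_simps)

lemma add_nmult: "nmult (m + n) x = nmult m x + nmult n x"
  by (induction m) (auto simp: algebra_simps)

lemma mult_nmult: "nmult (m * n) x = nmult m (nmult n x)"
  by (induction m) (auto simp: add_nmult)

lemma subgroup_nmult: "additive_subgroup_set H \<Longrightarrow> x \<in> H \<Longrightarrow> nmult n x \<in> H"
  by (induction n) (auto simp: subgroup_zero subgroup_add)

lemma subgroup_range_nmult: "additive_subgroup_set (range (nmult n))"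
  unfolding additive_subgroup_set_def
proof (intro conjI ballI)
  show "0 \<in> range (nmult n)" by (metis nmult_zero rangeI)
qed (auto simp flip: nmult_add nmult_uminus)

lemma subgroup_vimage_nmult:
  "additive_subgroup_set H \<Longrightarrow> additive_subgroup_set (nmult n -` H)"
  by (auto simp: additive_subgroup_set_def nmult_add nmult_uminus)

lemma subgroup_image_nmult:
  "additive_subgroup_set H \<Longrightarrow> additive_subgroup_set (nmult n ` H)"
  unfolding additive_subgroup_set_def
  by (auto simp flip: nmult_add nmult_uminus intro!: image_eqI[of 0 "nmult n" 0])

lemma continuous_nmult:
  "continuous_on UNIV (nmult n :: 'a::{topological_ab_group_add, t2_space} \<Rightarrow> 'a)"
  by (induction n) (auto intro!: continuous_intros)

section \<open>Open subgroups\<close>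

definition open_subgroup :: "'a::topological_ab_group_add set \<Rightarrow> bool" where
  "open_subgroup H \<longleftrightarrow> additive_subgroup_set H \<and> open H"

lemma open_translate:
  fixes U :: "'a::{topological_ab_group_add, t2_space} set"
  shows "open U \<Longrightarrow> open ((\<lambda>y. y - x) -` U)"
  by (intro open_vimage) (auto intro!: continuous_intros)

lemma subgroup_open_if_contains_open:
  fixes H :: "'a::{topological_ab_group_add, t2_space} set"
  assumes H: "additive_subgroup_set H" and U: "open U" "0 \<in> U" "U \<subseteq> H"
  shows "open_subgroup H"
proof -
  have "H = (\<Union>x\<in>H. (\<lambda>y. y - x) -` U)"
  proof (intro equalityI subsetI)
    fix x assume "x \<in> H" then show "x \<in> (\<Union>x\<in>H. (\<lambda>y. y - x) -` U)"
      using U by (intro UN_I[of x]) auto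
  next
    fix y assume "y \<in> (\<Union>x\<in>H. (\<lambda>y. y - x) -` U)"
    then obtain x where "x \<in> H" "y - x \<in> H" using U by auto
    then show "y \<in> H" using subgroup_add[OF H, of "y - x" x] by simp
  qed
  then show ?thesis
    unfolding open_subgroup_def using H open_translate[OF U(1)] by (metis open_UN)
qed

text \<open>
  The complement is a union of cosets, each of which is open.
\<close>

lemma open_subgroup_closed:
  fixes H :: "'a::{topological_ab_group_add, t2_space} set"
  assumes "open_subgroup H"
  shows "closed H"
proof -
  have H: "additive_subgroup_set H" "open H" using assms by (auto simp: open_subgroup_def)
  have "- H = (\<Union>x\<in>-H. (\<lambda>y. y - x) -` H)"
  proof (intro equalityI subsetI)
    fix x assume "x \<in> - H" then show "x \<in> (\<Union>x\<in>-H. (\<lambda>y. y - x) -` H)"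
      using subgroup_zero[OF H(1)] by (intro UN_I[of x]) auto
  next
    fix y assume "y \<in> (\<Union>x\<in>-H. (\<lambda>y. y - x) -` H)"
    then obtain x where "x \<notin> H" "y - x \<in> H" by auto
    then show "y \<in> - H" using subgroup_diff[OF H(1), of y "y - x"] by auto
  qed
  then have "open (- H)"
    using open_translate[OF H(2)] by (metis open_UN)
  then show ?thesis by (simp add: closed_def)
qed

lemma open_subgroup_Inter:
  fixes \<H> :: "'a::{topological_ab_group_add, t2_space} set set"
  assumes "finite \<H>" "\<And>H. H \<in> \<H> \<Longrightarrow> open_subgroup H"
  shows "open_subgroup (\<Inter>\<H>)"
  using assms subgroup_Inter[of \<H>] unfolding open_subgroup_def by (auto intro: open_Inter)

lemma open_subgroup_plus:
  fixes H :: "'a::{topological_ab_group_add, t2_space} set"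
  assumes "additive_subgroup_set H" "open_subgroup U"
  shows "open_subgroup (H + U)"
  using assms subgroup_plus[of H U] plus_superset[of H U] subgroup_zero[of U]
    subgroup_open_if_contains_open[of "H + U" U]
  by (auto simp: open_subgroup_def)

text \<open>
  The form in which compactness is used throughout: a statement about the intersection of an
  arbitrary family is reduced to finitely many members.
\<close>

lemma finite_Inter_subset_open:
  assumes "compact (UNIV :: 'a::topological_space set)"
    and cl: "\<And>C. C \<in> \<C> \<Longrightarrow> closed (C :: 'a set)" and "open W" "\<Inter>\<C> \<subseteq> W"
  obtains \<F> where "finite \<F>" "\<F> \<subseteq> \<C>" "\<Inter>\<F> \<subseteq> W"
proof -
  have "compact (- W)"
    using assms compact_Int_closed[of UNIV "- W"] by (simp add: closed_Compl)
  moreover have "- W \<inter> \<Inter>\<C> = {}" using \<open>\<Inter>\<C> \<subseteq> W\<close> by blast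
  ultimately obtain F where "finite F" "F \<subseteq> \<C>" "- W \<inter> \<Inter>F = {}"
    using compact_imp_fip[of "- W" \<C>] cl by metis
  then show thesis using that by blast
qed

lemma open_subgroup_finite_cosets:
  fixes U :: "'a::{topological_ab_group_add, t2_space} set"
  assumes cpt: "compact (UNIV :: 'a set)" and U: "open_subgroup U"
  shows "finite (range (\<lambda>x. (\<lambda>y. y - x) -` U))"
proof -
  have S: "additive_subgroup_set U" and "open U" using U by (auto simp: open_subgroup_def)
  obtain C where C: "finite C" "UNIV \<subseteq> (\<Union>x\<in>C. (\<lambda>y. y - x) -` U)"
    using compactE_image[OF cpt, of UNIV "\<lambda>x. (\<lambda>y. y - x) -` U"] open_translate[OF \<open>open U\<close>]
      subgroup_zero[OF S]
    by (smt (verit) UNIV_I UN_I diff_self subsetI vimageI)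
  have "(\<lambda>y. y - x) -` U \<in> (\<lambda>x. (\<lambda>y. y - x) -` U) ` C" for x
  proof -
    obtain c where c: "c \<in> C" "x - c \<in> U" using C by blast
    have "y - x \<in> U \<longleftrightarrow> y - c \<in> U" for y
      using subgroup_add[OF S c(2), of "y - x"] subgroup_diff[OF S _ c(2), of "y - c"] by auto
    then show ?thesis using c(1) by auto
  qed
  then show ?thesis using C(1) by (meson finite_imageI finite_subset image_subsetI)
qed

text \<open>
  The complement is the projection of the set of pairs \<open>(u, h)\<close> with \<open>u \<in> U\<close> and
  \<open>u + h \<notin> U\<close>, which is compact because \<open>U\<close> is clopen.
\<close>

lemma stabilizer_open:
  fixes U :: "'a::{topological_ab_group_add, t2_space} set"
  assumes cpt: "compact (UNIV :: 'a set)" and U: "open U" "closed U"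
  shows "open {h. \<forall>u\<in>U. u + h \<in> U}"
proof -
  have cs: "continuous_on UNIV (\<lambda>z::'a \<times> 'a. fst z + snd z)"
    by (intro continuous_intros)
  have "closed ((\<lambda>z::'a \<times> 'a. fst z + snd z) -` (- U))"
    using U(1) cs by (intro closed_vimage) auto
  moreover have "closed (fst -` U :: ('a \<times> 'a) set)"
    using U(2) by (intro closed_vimage) (auto intro: continuous_intros)
  moreover have "compact (UNIV :: ('a \<times> 'a) set)"
    using compact_Times[OF cpt cpt] by simp
  ultimately have "compact (UNIV \<inter> (fst -` U \<inter> (\<lambda>z::'a \<times> 'a. fst z + snd z) -` (- U)))"
    by blast
  then have "closed (snd ` (fst -` U \<inter> (\<lambda>z::'a \<times> 'a. fst z + snd z) -` (- U)))"
    by (auto intro!: compact_imp_closed compact_continuous_image continuous_intros)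
  moreover have "{h. \<forall>u\<in>U. u + h \<in> U} = - (snd ` (fst -` U \<inter> (\<lambda>z::'a \<times> 'a. fst z + snd z) -` (- U)))"
    by (auto simp: image_iff Bex_def)
  ultimately show ?thesis by (metis open_Compl)
qed

text \<open>
  The component of \<open>0\<close> is \<open>{0}\<close>, so there is a clopen set \<open>U\<close> with \<open>0 \<in> U \<subseteq> V\<close>. The elements \<open>h\<close>
  such that translation by \<open>h\<close> and by \<open>- h\<close> maps \<open>U\<close> into itself form an open subgroup, and
  \<open>0 + h \<in> U\<close> puts it inside \<open>V\<close>.
\<close>

lemma open_subgroup_base:
  fixes V :: "'a::{topological_ab_group_add, t2_space} set"
  assumes cpt: "compact (UNIV :: 'a set)"
    and td: "totally_disconnected_space (euclidean :: 'a topology)"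
    and V: "open V" "0 \<in> V"
  obtains H where "open_subgroup H" "H \<subseteq> V"
proof -
  let ?C = "connected_component_of_set (euclidean :: 'a topology) 0"
  have "0 \<in> ?C" by (simp add: connected_component_of_refl)
  moreover have "connectedin euclidean ?C" by (rule connectedin_connected_component_of)
  ultimately have C: "?C = {0}"
    using td unfolding totally_disconnected_space_def by blast
  have "{0::'a} \<in> connected_components_of euclidean"
    unfolding connected_components_of_def using C by (metis UNIV_I imageI topspace_euclidean)
  moreover have "locally_compact_space (euclidean :: 'a topology)"
    using cpt by (simp add: compact_imp_locally_compact_space compact_space_def)
  moreover have "Hausdorff_space (euclidean :: 'a topology)"
    unfolding Hausdorff_space_def using hausdorff by (auto simp: disjnt_def)
  ultimately obtain U W :: "'a set" where UW: "open U" "open W" "disjnt U W" "U \<union> W = UNIV" "0 \<in> U" "U \<subseteq> V"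
    using wilder_locally_compact_component_thm[of "euclidean :: 'a topology" "{0}" V] V by auto
  have "closed U"
  proof -
    have "- U = W" using UW by (auto simp: disjnt_iff)
    then show ?thesis using UW by (simp add: closed_def)
  qed
  define S where "S = {h. \<forall>u\<in>U. u + h \<in> U}"
  define H where "H = S \<inter> uminus -` S"
  have "open S" unfolding S_def using stabilizer_open[OF cpt \<open>open U\<close> \<open>closed U\<close>] .
  then have "open H" unfolding H_def
    by (intro open_Int open_vimage) (auto intro!: continuous_intros)
  moreover have "additive_subgroup_set H"
  proof -
    have add: "x + y \<in> S" if "x \<in> S" "y \<in> S" for x y
      using that unfolding S_def by (auto simp flip: add.assoc)
    have "- (x + y) \<in> S" if "- x \<in> S" "- y \<in> S" for x y
      using add[OF that] by simp
    moreover have "0 \<in> S" by (simp add: S_def)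
    ultimately show ?thesis
      using add unfolding H_def additive_subgroup_set_def by simp
  qed
  moreover have "H \<subseteq> V" using UW(5,6) unfolding H_def S_def by force
  ultimately show thesis using that unfolding open_subgroup_def by blast
qed

section \<open>Maximal open subgroups\<close>

definition maximal_open_subgroup :: "'a::topological_ab_group_add set \<Rightarrow> bool" where
  "maximal_open_subgroup M \<longleftrightarrow> open_subgroup M \<and> M \<noteq> UNIV \<and>
     (\<forall>L. additive_subgroup_set L \<and> M \<subseteq> L \<longrightarrow> L = M \<or> L = UNIV)"

lemma maximal_plus_eq_UNIV:
  assumes M: "maximal_open_subgroup M" and Q: "additive_subgroup_set Q" "\<not> Q \<subseteq> M"
  shows "M + Q = UNIV"
proof -
  have S: "additive_subgroup_set M"
    using M by (auto simp: maximal_open_subgroup_def open_subgroup_def)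
  have "additive_subgroup_set (M + Q)" "M \<subseteq> M + Q" "M + Q \<noteq> M"
    using subgroup_plus[OF S Q(1)] plus_superset[OF S Q(1)] Q(2) by auto
  then show ?thesis using M unfolding maximal_open_subgroup_def by blast
qed

lemma closed_image_nmult:
  fixes S :: "'a::{topological_ab_group_add, t2_space} set"
  assumes "compact (UNIV :: 'a set)" "closed S"
  shows "closed (nmult n ` S)"
proof -
  have "compact S" using assms compact_Int_closed[of UNIV S] by simp
  then show ?thesis
    by (intro compact_imp_closed compact_continuous_image continuous_on_subset[OF continuous_nmult]) auto
qed

text \<open>
  A subgroup \<open>M\<close> that contains \<open>pG\<close> and is maximal among the subgroups avoiding \<open>x\<close> is maximal
  outright, because \<open>G/M\<close> is generated by the class of \<open>x\<close>: for \<open>z \<notin> M\<close>, the subgroup generated by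
  \<open>M\<close> and \<open>z\<close> contains \<open>x\<close>, so \<open>x = a + j z\<close> with \<open>a \<in> M\<close>. Here \<open>p\<close> does not divide \<open>j\<close>, and
  inverting \<open>j\<close> modulo \<open>p\<close> expresses \<open>z\<close> through \<open>x\<close> and \<open>M\<close>.
\<close>

lemma nmult_prime_maximal_over:
  fixes x :: "'a::ab_group_add"
  assumes p: "prime p" and M: "additive_subgroup_set M" and pM: "range (nmult p) \<subseteq> M" and x: "x \<notin> M"
    and max: "\<And>L. additive_subgroup_set L \<Longrightarrow> M \<subseteq> L \<Longrightarrow> x \<notin> L \<Longrightarrow> L = M"
    and L: "additive_subgroup_set L" "M \<subseteq> L" "L \<noteq> M"
  shows "L = UNIV"
proof -
  have "x \<in> L" using max L by blast
  have "z \<in> L" for z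
  proof (cases "z \<in> M")
    case True then show ?thesis using L by blast
  next
    case False
    \<comment> \<open>The natural multiples suffice: modulo \<open>M\<close>, the multiple \<open>i (p - 1) z\<close> is the inverse
        of \<open>i z\<close>.\<close>
    define Z where "Z = range (\<lambda>j. nmult j z)"
    have "additive_subgroup_set (M + Z)"
      unfolding additive_subgroup_set_def
    proof (intro conjI ballI)
      have "0 = 0 + nmult 0 z" by simp
      then show "0 \<in> M + Z" using subgroup_zero[OF M] unfolding Z_def
        by (metis rangeI set_plus_intro)
    next
      fix u v assume "u \<in> M + Z" "v \<in> M + Z"
      then obtain a b i j where "u = a + nmult i z" "v = b + nmult j z" "a \<in> M" "b \<in> M"
        unfolding Z_def by (metis (no_types, lifting) rangeE set_plus_elim)
      then have "u + v = (a + b) + nmult (i + j) z" "a + b \<in> M"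
        using subgroup_add[OF M] by (auto simp: add_nmult algebra_simps)
      then show "u + v \<in> M + Z" unfolding Z_def by (metis rangeI set_plus_intro)
    next
      fix u assume "u \<in> M + Z"
      then obtain a i where u: "u = a + nmult i z" "a \<in> M"
        unfolding Z_def by (metis (no_types, lifting) rangeE set_plus_elim)
      have "nmult (i * p) z = nmult i z + nmult (i * (p - 1)) z"
        using prime_gt_0_nat[OF p] by (simp flip: add_nmult) (metis Suc_pred mult_Suc_right)
      then have "- u = - (a + nmult p (nmult i z)) + nmult (i * (p - 1)) z"
        using u by (simp add: algebra_simps flip: mult_nmult)
      moreover have "- (a + nmult p (nmult i z)) \<in> M"
        using u pM subgroup_add[OF M] subgroup_uminus[OF M] by blast
      ultimately show "- u \<in> M + Z" unfolding Z_def by (metis rangeI set_plus_intro)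
    qed
    moreover have "M \<subseteq> M + Z"
    proof
      fix a assume "a \<in> M"
      moreover have "a = a + nmult 0 z" by simp
      ultimately show "a \<in> M + Z" unfolding Z_def by (metis rangeI set_plus_intro)
    qed
    moreover have "z \<in> M + Z"
    proof -
      have "z = 0 + nmult (Suc 0) z" by simp
      then show ?thesis unfolding Z_def using subgroup_zero[OF M] by (metis rangeI set_plus_intro)
    qed
    ultimately have "x \<in> M + Z" using max[of "M + Z"] False by blast
    then obtain a j where j: "x = a + nmult j z" "a \<in> M"
      unfolding Z_def by (metis (no_types, lifting) rangeE set_plus_elim)
    have "\<not> p dvd j"
    proof
      assume "p dvd j"
      then obtain k where "j = p * k" by (auto elim: dvdE)
      then have "nmult j z \<in> M" using pM by (auto simp: mult_nmult)
      then show False using j subgroup_add[OF M] x by blast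
    qed
    then have "gcd j p = 1" using p by (metis coprime_commute coprime_iff_gcd_eq_1 prime_imp_coprime)
    moreover have "j \<noteq> 0" using \<open>\<not> p dvd j\<close> by (metis dvd_0_right)
    ultimately obtain k q where jk: "j * k = p * q + 1" using bezout_nat by metis
    have "nmult j z \<in> L" using \<open>x \<in> L\<close> subgroup_diff[OF L(1), of x a] j L(2) by auto
    then have "nmult (j * k) z \<in> L" using subgroup_nmult[OF L(1)] by (metis mult.commute mult_nmult)
    moreover have "nmult (j * k) z = nmult p (nmult q z) + z"
      by (subst jk) (simp add: add_nmult mult_nmult)
    moreover have "nmult p (nmult q z) \<in> L" using pM L(2) by blast
    ultimately show ?thesis using subgroup_diff[OF L(1)] by (metis add_diff_cancel_left')
  qed
  then show ?thesis by blast
qed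

text \<open>
  Since \<open>pG\<close> is closed, some open subgroup \<open>pG + U\<close> still avoids \<open>x\<close>. Zorn's lemma extends it to a
  subgroup maximal with that property, which is open because it contains \<open>pG + U\<close>.
\<close>

lemma maximal_open_subgroup_avoiding:
  fixes x :: "'a::{topological_ab_group_add, t2_space}"
  assumes cpt: "compact (UNIV :: 'a set)"
    and base: "\<And>V :: 'a set. open V \<Longrightarrow> 0 \<in> V \<Longrightarrow> \<exists>H. open_subgroup H \<and> H \<subseteq> V"
    and p: "prime p" and x: "x \<notin> range (nmult p)"
  obtains M where "maximal_open_subgroup M" "x \<notin> M"
proof -
  let ?P = "range (nmult p) :: 'a set"
  have "closed ?P" using closed_image_nmult[OF cpt, of UNIV p] by simp
  then have "open ((\<lambda>u. x - u) -` (- ?P))"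
    by (intro open_vimage) (auto intro!: continuous_intros)
  then obtain U where U: "open_subgroup U" "U \<subseteq> (\<lambda>u. x - u) -` (- ?P)"
    using base[of "(\<lambda>u. x - u) -` (- ?P)"] x by auto
  have P: "additive_subgroup_set ?P" by (rule subgroup_range_nmult)
  have UP: "open_subgroup (?P + U)" using open_subgroup_plus[OF P U(1)] .
  have "x \<notin> ?P + U"
  proof
    assume "x \<in> ?P + U"
    then obtain a u where "x = a + u" "a \<in> ?P" "u \<in> U" by (metis set_plus_elim)
    then have "x - u \<in> ?P" by simp
    then show False using U(2) \<open>u \<in> U\<close> by blast
  qed
  define \<A> where "\<A> = {L. additive_subgroup_set L \<and> ?P + U \<subseteq> L \<and> x \<notin> L}"
  have "\<A> \<noteq> {}" using UP \<open>x \<notin> ?P + U\<close> unfolding \<A>_def open_subgroup_def by blast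
  moreover have "\<Union>\<C> \<in> \<A>" if ne: "\<C> \<noteq> {}" and ch: "subset.chain \<A> \<C>" for \<C>
  proof -
    have sub: "L \<in> \<A>" if "L \<in> \<C>" for L using ch that by (auto simp: subset.chain_def)
    have "additive_subgroup_set (\<Union>\<C>)"
      unfolding additive_subgroup_set_def
    proof (intro conjI ballI)
      show "0 \<in> \<Union>\<C>" using ne sub subgroup_zero unfolding \<A>_def by blast
    next
      fix u v assume "u \<in> \<Union>\<C>" "v \<in> \<Union>\<C>"
      then obtain L where "L \<in> \<C>" "u \<in> L" "v \<in> L"
        using ch unfolding subset_chain_def by blast
      then show "u + v \<in> \<Union>\<C>" using sub subgroup_add unfolding \<A>_def by blast
    next
      fix u assume "u \<in> \<Union>\<C>"
      then show "- u \<in> \<Union>\<C>" using sub subgroup_uminus unfolding \<A>_def by blast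
    qed
    then show ?thesis using ne sub unfolding \<A>_def by blast
  qed
  ultimately obtain M where M: "M \<in> \<A>" "\<And>L. L \<in> \<A> \<Longrightarrow> M \<subseteq> L \<Longrightarrow> L = M"
    using subset_Zorn_nonempty[of \<A>] by metis
  have sM: "additive_subgroup_set M" "?P + U \<subseteq> M" "x \<notin> M" using M(1) by (auto simp: \<A>_def)
  have "?P \<subseteq> M" using sM(2) plus_superset[OF P, of U] U(1) by (auto simp: open_subgroup_def)
  have "open_subgroup M"
    using subgroup_open_if_contains_open[OF sM(1) _ _ sM(2)] UP subgroup_zero
    unfolding open_subgroup_def by blast
  moreover have "L = UNIV" if "additive_subgroup_set L" "M \<subseteq> L" "L \<noteq> M" for L
    using nmult_prime_maximal_over[OF p sM(1) \<open>?P \<subseteq> M\<close> sM(3) _ that] M(2) sM(2)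
    unfolding \<A>_def by blast
  ultimately have "maximal_open_subgroup M"
    unfolding maximal_open_subgroup_def using sM(3) by blast
  then show thesis using that sM(3) by blast
qed

section \<open>Independent families\<close>

text \<open>
  For maximal subgroups \<open>ker \<chi>\<close> given by characters \<open>\<chi>\<close> of order \<open>p\<close>, this is linear independence of the
  characters \<open>\<chi>\<close> over the field with \<open>p\<close> elements.
\<close>

definition independent_subgroups :: "'a set set \<Rightarrow> bool" where
  "independent_subgroups \<I> \<longleftrightarrow> (\<forall>M\<in>\<I>. \<forall>\<F>. finite \<F> \<and> \<F> \<subseteq> \<I> - {M} \<longrightarrow> \<not> \<Inter>\<F> \<subseteq> M)"

lemma independent_subgroupsD:
  "independent_subgroups \<I> \<Longrightarrow> M \<in> \<I> \<Longrightarrow> finite \<F> \<Longrightarrow> \<F> \<subseteq> \<I> - {M} \<Longrightarrow> \<not> \<Inter>\<F> \<subseteq> M"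
  by (simp add: independent_subgroups_def)

text \<open>
  The exchange property. Otherwise \<open>P \<inter> i\<close> together with \<open>M\<close> generates the whole group, and
  splitting an element of \<open>P\<close> accordingly writes it as a sum of elements of \<open>P \<inter> M\<close> and
  \<open>P \<inter> i\<close>, both of which are contained in \<open>i\<close>.
\<close>

lemma maximal_exchange:
  assumes M: "maximal_open_subgroup M" and i: "additive_subgroup_set i"
    and P: "additive_subgroup_set P" "\<not> P \<subseteq> i" and sub: "P \<inter> M \<subseteq> i"
  shows "P \<inter> i \<subseteq> M"
proof (rule ccontr)
  assume "\<not> P \<inter> i \<subseteq> M"
  then have eq: "M + (P \<inter> i) = UNIV" using maximal_plus_eq_UNIV[OF M subgroup_Int[OF P(1) i]] by simp
  have "P \<subseteq> i"
  proof
    fix g assume "g \<in> P"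
    obtain m q where g: "g = m + q" "m \<in> M" "q \<in> P" "q \<in> i"
      using eq by (metis Int_iff UNIV_I set_plus_elim)
    then have "m \<in> P" using subgroup_diff[OF P(1) \<open>g \<in> P\<close> \<open>q \<in> P\<close>] by simp
    then show "g \<in> i" using g sub subgroup_add[OF i] by blast
  qed
  then show False using P(2) by blast
qed

text \<open>
  Independence is a condition on finite subfamilies, so Zorn's lemma yields a maximal independent
  family. If \<open>M\<close> cannot be added to it, then either \<open>M\<close> contains a finite intersection of members,
  or adding \<open>M\<close> makes some member \<open>i\<close> dependent; the exchange property turns the second case into
  a finite intersection, now involving \<open>i\<close>, that \<open>M\<close> contains.
\<close>

lemma maximal_independent_family:
  obtains \<I> :: "'a::topological_ab_group_add set set" where
    "\<And>M. M \<in> \<I> \<Longrightarrow> maximal_open_subgroup M" "independent_subgroups \<I>"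
    "\<And>M. maximal_open_subgroup M \<Longrightarrow> \<Inter>\<I> \<subseteq> M"
proof -
  define \<A> where "\<A> = {\<I>. \<I> \<subseteq> Collect maximal_open_subgroup \<and> independent_subgroups (\<I> :: 'a set set)}"
  have "\<Union>\<C> \<in> \<A>" if ch: "subset.chain \<A> \<C>" for \<C>
  proof -
    have sub: "\<C> \<subseteq> \<A>" using ch by (auto simp: subset.chain_def)
    have "\<not> \<Inter>\<F> \<subseteq> M" if MF: "M \<in> \<Union>\<C>" "finite \<F>" "\<F> \<subseteq> \<Union>\<C> - {M}" for M \<F>
    proof -
      have "finite (insert M \<F>)" "insert M \<F> \<subseteq> \<Union>\<C>" "\<C> \<noteq> {}" using MF by auto
      then obtain \<I> where "\<I> \<in> \<C>" "insert M \<F> \<subseteq> \<I>"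
        using finite_subset_Union_chain[OF _ _ _ ch] by metis
      then have "independent_subgroups \<I>" "M \<in> \<I>" "\<F> \<subseteq> \<I> - {M}"
        using sub MF by (auto simp: \<A>_def)
      then show ?thesis using MF(2) independent_subgroupsD by metis
    qed
    then have "independent_subgroups (\<Union>\<C>)" unfolding independent_subgroups_def by blast
    then show ?thesis using sub unfolding \<A>_def by blast
  qed
  then obtain \<I> where "\<I> \<in> \<A>" and mx: "\<And>\<J>. \<J> \<in> \<A> \<Longrightarrow> \<I> \<subseteq> \<J> \<Longrightarrow> \<J> = \<I>"
    using subset_Zorn'[of \<A>] by metis
  then have I: "\<And>M. M \<in> \<I> \<Longrightarrow> maximal_open_subgroup M" and ind: "independent_subgroups \<I>"
    by (auto simp: \<A>_def)
  have sI: "additive_subgroup_set M" if "M \<in> \<I>" for M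
    using I[OF that] by (simp add: maximal_open_subgroup_def open_subgroup_def)
  have "\<Inter>\<I> \<subseteq> M" if M: "maximal_open_subgroup M" for M
  proof (cases "M \<in> \<I>")
    case False
    then have "\<not> independent_subgroups (insert M \<I>)"
      using mx[of "insert M \<I>"] I M unfolding \<A>_def by blast
    then obtain i \<F> where i: "i \<in> insert M \<I>" "finite \<F>" "\<F> \<subseteq> insert M \<I> - {i}" "\<Inter>\<F> \<subseteq> i"
      unfolding independent_subgroups_def by blast
    show ?thesis
    proof (cases "i = M")
      case True
      then have "\<F> \<subseteq> \<I>" using i(3) by auto
      then have "\<Inter>\<I> \<subseteq> \<Inter>\<F>" by (rule Inter_anti_mono)
      then show ?thesis using i(4) True by simp
    next
      case False
      then have "i \<in> \<I>" using i by blast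
      have fin: "finite (\<F> - {M})" "\<F> - {M} \<subseteq> \<I> - {i}" using i by auto
      then have nP: "\<not> \<Inter>(\<F> - {M}) \<subseteq> i"
        using independent_subgroupsD[OF ind \<open>i \<in> \<I>\<close>] by metis
      have "additive_subgroup_set (\<Inter>(\<F> - {M}))" using fin sI by (intro subgroup_Inter) blast
      moreover have "\<Inter>(\<F> - {M}) \<inter> M \<subseteq> i" using i(4) by (auto simp: subset_iff)
      ultimately have "\<Inter>(\<F> - {M}) \<inter> i \<subseteq> M"
        using maximal_exchange[OF M sI[OF \<open>i \<in> \<I>\<close>] _ nP] by simp
      moreover have "\<Inter>\<I> \<subseteq> \<Inter>(\<F> - {M})" using fin(2) by (intro Inter_anti_mono) auto
      moreover have "\<Inter>\<I> \<subseteq> i" using \<open>i \<in> \<I>\<close> by (rule Inter_lower)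
      ultimately show ?thesis by (meson Int_greatest subset_trans)
    qed
  qed blast
  then show thesis using that I ind by blast
qed

text \<open>
  Independence excludes finite intersections only; as \<open>M\<close> is open, compactness excludes the
  intersection of all other members as well.
\<close>

lemma independent_complementary_element:
  fixes \<I> :: "'a::{topological_ab_group_add, t2_space} set set"
  assumes cpt: "compact (UNIV :: 'a set)"
    and I: "\<And>M. M \<in> \<I> \<Longrightarrow> open_subgroup M" and ind: "independent_subgroups \<I>" and M: "M \<in> \<I>"
  obtains x where "x \<notin> M" "\<And>N. N \<in> \<I> \<Longrightarrow> N \<noteq> M \<Longrightarrow> x \<in> N"
proof -
  have "\<not> \<Inter>(\<I> - {M}) \<subseteq> M"
  proof
    assume sub: "\<Inter>(\<I> - {M}) \<subseteq> M"
    obtain \<F> where "finite \<F>" "\<F> \<subseteq> \<I> - {M}" "\<Inter>\<F> \<subseteq> M"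
    proof (rule finite_Inter_subset_open[OF cpt _ _ sub])
      show "open M" using I[OF M] by (simp add: open_subgroup_def)
    qed (use I open_subgroup_closed in auto)
    then show False using independent_subgroupsD[OF ind M] by metis
  qed
  then show thesis using that by blast
qed

text \<open>
  The preimage of the direct sum under the map from \<open>G\<close> to the product of the quotients \<open>G/M\<close> with
  \<open>M \<in> \<I>\<close>.
\<close>

definition finitely_supported :: "'a set set \<Rightarrow> 'a set" where
  "finitely_supported \<I> = {x. finite {M \<in> \<I>. x \<notin> M}}"

lemma subgroup_finitely_supported:
  fixes \<I> :: "'a::ab_group_add set set"
  assumes I: "\<And>M. M \<in> \<I> \<Longrightarrow> additive_subgroup_set M"
  shows "additive_subgroup_set (finitely_supported \<I>)"
  unfolding additive_subgroup_set_def
proof (intro conjI ballI)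
  have "{M \<in> \<I>. 0 \<notin> M} = {}" using I subgroup_zero by auto
  then show "0 \<in> finitely_supported \<I>"
    unfolding finitely_supported_def mem_Collect_eq by (simp only: finite.emptyI)
next
  fix x y assume "x \<in> finitely_supported \<I>" "y \<in> finitely_supported \<I>"
  then have "finite ({M \<in> \<I>. x \<notin> M} \<union> {M \<in> \<I>. y \<notin> M})" by (simp add: finitely_supported_def)
  moreover have "{M \<in> \<I>. x + y \<notin> M} \<subseteq> {M \<in> \<I>. x \<notin> M} \<union> {M \<in> \<I>. y \<notin> M}"
    using I subgroup_add by blast
  ultimately show "x + y \<in> finitely_supported \<I>"
    unfolding finitely_supported_def by (auto intro: finite_subset)
next
  fix x assume "x \<in> finitely_supported \<I>"
  moreover have "{M \<in> \<I>. - x \<notin> M} \<subseteq> {M \<in> \<I>. x \<notin> M}"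
    using I subgroup_uminus by blast
  ultimately show "- x \<in> finitely_supported \<I>"
    unfolding finitely_supported_def by (auto intro: finite_subset)
qed

text \<open>
  Coordinates can be cleared one at a time. Suppose that \<open>g - d\<close> lies in \<open>\<Inter>\<F>\<close> already. The element
  complementary to a new member \<open>M\<close> is finitely supported, lies in \<open>\<Inter>\<F>\<close> and not in \<open>M\<close>; by
  maximality of \<open>M\<close>, the finitely supported elements of \<open>\<Inter>\<F>\<close> then represent all classes modulo \<open>M\<close>,
  so \<open>d\<close> can be corrected without leaving \<open>\<Inter>\<F>\<close>.
\<close>

lemma finitely_supported_plus_finite_Inter:
  fixes \<I> :: "'a::{topological_ab_group_add, t2_space} set set"
  assumes cpt: "compact (UNIV :: 'a set)"
    and I: "\<And>M. M \<in> \<I> \<Longrightarrow> maximal_open_subgroup M" and ind: "independent_subgroups \<I>"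
    and F: "finite \<F>" "\<F> \<subseteq> \<I>"
  shows "\<exists>d\<in>finitely_supported \<I>. g - d \<in> \<Inter>\<F>"
  using F
proof (induction \<F>)
  case empty
  have "additive_subgroup_set M" if "M \<in> \<I>" for M
    using I[OF that] by (simp add: maximal_open_subgroup_def open_subgroup_def)
  then show ?case using subgroup_zero[OF subgroup_finitely_supported] by auto
next
  case (insert M \<F>)
  let ?D = "finitely_supported \<I>"
  have oI: "open_subgroup M" if "M \<in> \<I>" for M
    using I[OF that] by (simp add: maximal_open_subgroup_def)
  then have sI: "additive_subgroup_set M" if "M \<in> \<I>" for M
    using that by (simp add: open_subgroup_def)
  have D: "additive_subgroup_set ?D" using sI by (rule subgroup_finitely_supported)
  have F: "additive_subgroup_set (\<Inter>\<F>)" using insert.prems sI by (intro subgroup_Inter) auto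
  obtain d where d: "d \<in> ?D" "g - d \<in> \<Inter>\<F>" using insert by auto
  obtain x where x: "x \<notin> M" "\<And>N. N \<in> \<I> \<Longrightarrow> N \<noteq> M \<Longrightarrow> x \<in> N"
    using independent_complementary_element[OF cpt oI ind, of M] insert.prems by auto
  have "{N \<in> \<I>. x \<notin> N} \<subseteq> {M}" using x by blast
  then have "x \<in> ?D" unfolding finitely_supported_def using finite_subset by auto
  moreover have "x \<in> \<Inter>\<F>" using x insert by blast
  ultimately have "\<not> ?D \<inter> \<Inter>\<F> \<subseteq> M" using x(1) by blast
  then have "M + (?D \<inter> \<Inter>\<F>) = UNIV"
    using maximal_plus_eq_UNIV[OF _ subgroup_Int[OF D F]] I insert.prems by simp
  then obtain m d' where md: "g - d = m + d'" "m \<in> M" "d' \<in> ?D" "d' \<in> \<Inter>\<F>"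
    by (metis Int_iff UNIV_I set_plus_elim)
  have "g - (d + d') = m" using md(1) by (simp add: algebra_simps)
  moreover have "m = (g - d) - d'" using md(1) by (simp add: algebra_simps)
  then have "m \<in> \<Inter>\<F>" using subgroup_diff[OF F d(2) md(4)] by simp
  ultimately have "g - (d + d') \<in> \<Inter>(insert M \<F>)" using md(2) by simp
  then show ?case using subgroup_add[OF D d(1) md(3)] by blast
qed

text \<open>
  For an open subgroup \<open>U\<close>, compactness gives a finite \<open>\<F> \<subseteq> \<I>\<close> with
  \<open>\<Inter>\<F> \<subseteq> \<Inter>\<I> + U\<close>. After clearing the coordinates in \<open>\<F>\<close>, what remains of \<open>g\<close> is therefore
  in \<open>\<Inter>\<I>\<close> up to an element of \<open>U\<close>, and \<open>\<Inter>\<I>\<close> consists of elements of empty support.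
\<close>

lemma finitely_supported_dense:
  fixes \<I> :: "'a::{topological_ab_group_add, t2_space} set set"
  assumes cpt: "compact (UNIV :: 'a set)"
    and base: "\<And>V :: 'a set. open V \<Longrightarrow> 0 \<in> V \<Longrightarrow> \<exists>H. open_subgroup H \<and> H \<subseteq> V"
    and I: "\<And>M. M \<in> \<I> \<Longrightarrow> maximal_open_subgroup M" and ind: "independent_subgroups \<I>"
  shows "closure (finitely_supported \<I>) = UNIV"
proof -
  let ?D = "finitely_supported \<I>"
  have oI: "open_subgroup M" if "M \<in> \<I>" for M
    using I[OF that] by (simp add: maximal_open_subgroup_def)
  then have sI: "additive_subgroup_set M" if "M \<in> \<I>" for M
    using that by (simp add: open_subgroup_def)
  have D: "additive_subgroup_set ?D" using sI by (rule subgroup_finitely_supported)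
  have K: "additive_subgroup_set (\<Inter>\<I>)" using sI by (rule subgroup_Inter)
  have KD: "\<Inter>\<I> \<subseteq> ?D"
  proof
    fix x assume "x \<in> \<Inter>\<I>"
    then have "{M \<in> \<I>. x \<notin> M} = {}" by blast
    then show "x \<in> ?D" unfolding finitely_supported_def mem_Collect_eq by (simp only: finite.emptyI)
  qed
  have "\<exists>d\<in>?D. d \<in> T" if T: "open T" "g \<in> T" for g T
  proof -
    have "open ((\<lambda>u. g - u) -` T)"
      using T by (intro open_vimage) (auto intro!: continuous_intros)
    then obtain U where U: "open_subgroup U" "U \<subseteq> (\<lambda>u. g - u) -` T"
      using base[of "(\<lambda>u. g - u) -` T"] T by auto
    have KU: "open_subgroup (\<Inter>\<I> + U)" using open_subgroup_plus[OF K U(1)] .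
    obtain \<F> where F: "finite \<F>" "\<F> \<subseteq> \<I>" "\<Inter>\<F> \<subseteq> \<Inter>\<I> + U"
    proof (rule finite_Inter_subset_open[OF cpt, of \<I> "\<Inter>\<I> + U"])
      show "closed C" if "C \<in> \<I>" for C using open_subgroup_closed oI that by blast
      show "open (\<Inter>\<I> + U)" using KU by (simp add: open_subgroup_def)
      show "\<Inter>\<I> \<subseteq> \<Inter>\<I> + U" using plus_superset[OF K, of U] U(1) by (simp add: open_subgroup_def)
    qed auto
    obtain d where d: "d \<in> ?D" "g - d \<in> \<Inter>\<F>"
      using finitely_supported_plus_finite_Inter[OF cpt I ind F(1,2)] by blast
    obtain c u where cu: "g - d = c + u" "c \<in> \<Inter>\<I>" "u \<in> U" using d(2) F(3) by (meson set_plus_elim subsetD)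
    have "g - u = d + c" using cu(1) by (simp add: algebra_simps)
    then have "g - u \<in> ?D" using subgroup_add[OF D d(1)] cu(2) KD by auto
    then show ?thesis using U(2) cu(3) by blast
  qed
  then show ?thesis unfolding closure_def islimpt_def by auto
qed

text \<open>
  A countable set \<open>C\<close> of finitely supported elements has countable total support. Any \<open>M \<in> \<I>\<close>
  outside that support contains \<open>C\<close> and, being closed, the closure of \<open>C\<close>.
\<close>

lemma independent_family_countable:
  fixes \<I> :: "'a::{topological_ab_group_add, t2_space} set set"
  assumes cpt: "compact (UNIV :: 'a set)"
    and base: "\<And>V :: 'a set. open V \<Longrightarrow> 0 \<in> V \<Longrightarrow> \<exists>H. open_subgroup H \<and> H \<subseteq> V"
    and sep: "dense_subgroup_separable TYPE('a)"
    and I: "\<And>M. M \<in> \<I> \<Longrightarrow> maximal_open_subgroup M" and ind: "independent_subgroups \<I>"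
  shows "countable \<I>"
proof (rule ccontr)
  assume unc: "uncountable \<I>"
  let ?D = "finitely_supported \<I>"
  have dense: "closure ?D = UNIV" using finitely_supported_dense[OF cpt base I ind] by blast
  have "additive_subgroup_set M" if "M \<in> \<I>" for M
    using I[OF that] by (simp add: maximal_open_subgroup_def open_subgroup_def)
  then have "additive_subgroup_set ?D" by (rule subgroup_finitely_supported)
  then have "separable_space (top_of_set ?D)"
    using sep dense unfolding dense_subgroup_separable_def by blast
  then obtain C where C: "countable C" "C \<subseteq> ?D" "top_of_set ?D closure_of C = ?D"
    unfolding separable_space_def by auto
  have "?D \<subseteq> closure C"
  proof -
    have "?D = ?D \<inter> closure (?D \<inter> C)" using C(3) by (simp add: closure_of_subtopology)
    then show ?thesis using C(2) by (metis Int_absorb1 Int_lower2)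
  qed
  have "countable (\<Union>c\<in>C. {M \<in> \<I>. c \<notin> M})"
    using C(1,2) by (intro countable_UN) (auto simp: finitely_supported_def intro: countable_finite)
  then obtain M where M: "M \<in> \<I>" "C \<subseteq> M"
    using unc by (smt (verit) UN_iff countable_subset mem_Collect_eq subsetI)
  have "closed M" using I[OF M(1)] by (simp add: maximal_open_subgroup_def open_subgroup_closed)
  then have "closure C \<subseteq> M" using M(2) by (simp add: closure_minimal)
  then have "closure ?D \<subseteq> M" using \<open>?D \<subseteq> closure C\<close> \<open>closed M\<close> by (simp add: closure_minimal)
  then show False using dense I[OF M(1)] by (auto simp: maximal_open_subgroup_def)
qed

section \<open>Countably many open subgroups\<close>

text \<open>
  For a closed subgroup \<open>L\<close> of a compact group whose open subgroups form a base at \<open>0\<close>, this says that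
  \<open>L\<close> is a \<open>G\<^sub>\<delta>\<close> set, or equivalently that the quotient by \<open>L\<close> is metrizable. Asking for an inclusion in
  \<open>L\<close>, not for an equality, makes the property obviously inherited by larger sets.
\<close>

definition countable_open_type :: "'a::topological_ab_group_add set \<Rightarrow> bool" where
  "countable_open_type L \<longleftrightarrow>
     (\<exists>\<U>. countable \<U> \<and> (\<forall>U\<in>\<U>. open_subgroup U) \<and> \<Inter>\<U> \<subseteq> L)"

lemma countable_open_typeE:
  assumes "countable_open_type L"
  obtains \<U> where "countable \<U>" "\<And>U. U \<in> \<U> \<Longrightarrow> open_subgroup U" "\<Inter>\<U> \<subseteq> L"
  using assms by (auto simp: countable_open_type_def)

text \<open>
  Multiplication by \<open>n\<close> is open as a map onto its image. With \<open>T\<close> the saturation of \<open>U\<close>, which is an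
  open subgroup, the complement of \<open>n U\<close> in \<open>nG\<close> is the image of the compact set \<open>- T\<close>, and hence
  is closed.
\<close>

lemma range_nmult_trace_of_open:
  fixes U :: "'a::{topological_ab_group_add, t2_space} set"
  assumes cpt: "compact (UNIV :: 'a set)"
    and base: "\<And>V :: 'a set. open V \<Longrightarrow> 0 \<in> V \<Longrightarrow> \<exists>H. open_subgroup H \<and> H \<subseteq> V"
    and U: "open_subgroup U"
  shows "\<exists>W. open_subgroup W \<and> range (nmult n) \<inter> W \<subseteq> nmult n ` U"
proof -
  define T where "T = nmult n -` (nmult n ` U)"
  have sU: "additive_subgroup_set U" "open U" using U by (auto simp: open_subgroup_def)
  have sT: "additive_subgroup_set T"
    unfolding T_def by (intro subgroup_vimage_nmult subgroup_image_nmult sU)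
  have "open_subgroup T"
    using subgroup_open_if_contains_open[OF sT sU(2) subgroup_zero[OF sU(1)]] unfolding T_def by auto
  then have "closed (- T)" by (simp add: open_subgroup_def closed_Compl)
  then have "open (- (nmult n ` (- T)))" using closed_image_nmult[OF cpt] by blast
  moreover have "0 \<notin> nmult n ` (- T)"
  proof
    assume "0 \<in> nmult n ` (- T)"
    then obtain y where "y \<notin> T" "nmult n y = nmult n 0" by auto
    then show False using subgroup_zero[OF sU(1)] unfolding T_def by (metis imageI vimageI)
  qed
  ultimately obtain W where "open_subgroup W" "W \<subseteq> - (nmult n ` (- T))"
    using base by (metis ComplI)
  then show ?thesis unfolding T_def by blast
qed

text \<open>
  Let \<open>\<U>\<close> be a countable family with \<open>\<Inter>\<U> \<subseteq> mG\<close>. For every finite \<open>\<F> \<subseteq> \<U>\<close> choose an open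
  subgroup that meets \<open>nG\<close> inside \<open>n (\<Inter>\<F>)\<close>. If \<open>x \<in> nG\<close> lies in all of them, then the closed
  fibre of \<open>x\<close> meets every finite intersection \<open>\<Inter>\<F>\<close>, so by compactness it meets \<open>\<Inter>\<U>\<close>.
  Thus \<open>x = n g\<close> with \<open>g \<in> mG\<close>.
\<close>

lemma countable_open_type_nmult_mult:
  fixes m n :: nat
  assumes cpt: "compact (UNIV :: 'a::{topological_ab_group_add, t2_space} set)"
    and base: "\<And>V :: 'a set. open V \<Longrightarrow> 0 \<in> V \<Longrightarrow> \<exists>H. open_subgroup H \<and> H \<subseteq> V"
    and m: "countable_open_type (range (nmult m :: 'a \<Rightarrow> 'a))"
    and n: "countable_open_type (range (nmult n :: 'a \<Rightarrow> 'a))"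
  shows "countable_open_type (range (nmult (m * n) :: 'a \<Rightarrow> 'a))"
proof -
  obtain \<U> :: "'a set set" where U: "countable \<U>" "\<And>U. U \<in> \<U> \<Longrightarrow> open_subgroup U" "\<Inter>\<U> \<subseteq> range (nmult m)"
    using countable_open_typeE[OF m] by metis
  obtain \<V> :: "'a set set" where V: "countable \<V>" "\<And>U. U \<in> \<V> \<Longrightarrow> open_subgroup U" "\<Inter>\<V> \<subseteq> range (nmult n)"
    using countable_open_typeE[OF n] by metis
  define Fs where "Fs = {\<F>. finite \<F> \<and> \<F> \<subseteq> \<U>}"
  have "\<exists>W. open_subgroup W \<and> range (nmult n) \<inter> W \<subseteq> nmult n ` (\<Inter>\<F>)" if "\<F> \<in> Fs" for \<F>
    using that range_nmult_trace_of_open[OF cpt base open_subgroup_Inter[of \<F>]] U(2)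
    unfolding Fs_def by blast
  then obtain W where W: "\<And>\<F>. \<F> \<in> Fs \<Longrightarrow> open_subgroup (W \<F>)"
      "\<And>\<F>. \<F> \<in> Fs \<Longrightarrow> range (nmult n) \<inter> W \<F> \<subseteq> nmult n ` (\<Inter>\<F>)"
    by metis
  have "x \<in> range (nmult (m * n))" if x: "x \<in> \<Inter>(\<V> \<union> W ` Fs)" for x
  proof -
    have xn: "x \<in> range (nmult n)" using x V(3) by auto
    have "\<not> \<Inter>\<U> \<subseteq> - (nmult n -` {x})"
    proof
      assume sub: "\<Inter>\<U> \<subseteq> - (nmult n -` {x})"
      have "closed (nmult n -` {x})" by (intro closed_vimage continuous_nmult) auto
      then obtain \<F> where F: "finite \<F>" "\<F> \<subseteq> \<U>" "\<Inter>\<F> \<subseteq> - (nmult n -` {x})"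
        using finite_Inter_subset_open[OF cpt _ _ sub] U(2) open_subgroup_closed by (metis open_Compl)
      then have "\<F> \<in> Fs" by (simp add: Fs_def)
      then have "x \<in> nmult n ` (\<Inter>\<F>)" using W(2) x xn by blast
      then show False using F(3) by auto
    qed
    then obtain g where "g \<in> \<Inter>\<U>" "nmult n g = x" by auto
    then obtain h where "x = nmult n (nmult m h)" using U(3) by auto
    then show ?thesis by (metis mult.commute mult_nmult rangeI)
  qed
  moreover have "countable (\<V> \<union> W ` Fs)"
    unfolding Fs_def using U(1) V(1) by (simp add: countable_Collect_finite_subset)
  moreover have "\<forall>U\<in>\<V> \<union> W ` Fs. open_subgroup U" using V(2) W(1) by auto
  ultimately show ?thesis unfolding countable_open_type_def by blast
qed

lemma countable_open_type_nmult:
  assumes cpt: "compact (UNIV :: 'a::{topological_ab_group_add, t2_space} set)"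
    and base: "\<And>V :: 'a set. open V \<Longrightarrow> 0 \<in> V \<Longrightarrow> \<exists>H. open_subgroup H \<and> H \<subseteq> V"
    and prime: "\<And>p. prime p \<Longrightarrow> countable_open_type (range (nmult p :: 'a \<Rightarrow> 'a))"
    and "n > 0"
  shows "countable_open_type (range (nmult n :: 'a \<Rightarrow> 'a))"
  using \<open>n > 0\<close>
proof (induction n rule: prime_divisors_induct)
  case (unit n)
  then have "range (nmult n :: 'a \<Rightarrow> 'a) = UNIV" by (auto simp: image_iff)
  then show ?case unfolding countable_open_type_def by (intro exI[of _ "{}"]) auto
next
  case (factor p n)
  then show ?case using countable_open_type_nmult_mult[OF cpt base prime] by simp
qed simp

text \<open>
  The quotient by \<open>H\<close> is finite, so each element has a positive multiple in \<open>H\<close> by the pigeonhole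
  principle. Compactness makes finitely many multipliers sufficient, and their product works for
  all elements.
\<close>

lemma open_subgroup_contains_multiples:
  fixes H :: "'a::{topological_ab_group_add, t2_space} set"
  assumes cpt: "compact (UNIV :: 'a set)" and H: "open_subgroup H"
  obtains n where "n > 0" "range (nmult n) \<subseteq> H"
proof -
  have S: "additive_subgroup_set H" "open H" using H by (auto simp: open_subgroup_def)
  have ex: "\<exists>n>0. nmult n x \<in> H" for x
  proof -
    let ?c = "\<lambda>k. (\<lambda>y. y - nmult k x) -` H"
    have "finite (range ?c)"
      by (rule finite_subset[OF _ open_subgroup_finite_cosets[OF cpt H]]) auto
    then have "\<not> inj ?c" using finite_imageD infinite_UNIV_nat by blast
    then obtain j k where jk: "j < k" "?c j = ?c k"
      unfolding inj_def by (metis linorder_neqE_nat)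
    have "nmult k x \<in> ?c k" using subgroup_zero[OF S(1)] by simp
    then have "nmult k x - nmult j x \<in> H" using jk(2) by auto
    moreover have "nmult k x = nmult (k - j) x + nmult j x" using jk(1) by (simp flip: add_nmult)
    ultimately show ?thesis using jk(1) by (intro exI[of _ "k - j"]) simp
  qed
  have op: "open (nmult n -` H)" for n
    using S(2) by (intro open_vimage continuous_nmult)
  have "UNIV \<subseteq> (\<Union>n\<in>{0<..}. nmult n -` H)" using ex by (auto simp: Bex_def)
  then obtain D where D: "D \<subseteq> {0<..}" "finite D" "UNIV \<subseteq> (\<Union>n\<in>D. nmult n -` H)"
    by (rule compactE_image[OF cpt op])
  have "nmult (\<Prod>D) x \<in> H" for x
  proof -
    obtain i where i: "i \<in> D" "nmult i x \<in> H" using D(3) by blast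
    have "\<Prod>D = \<Prod>(D - {i}) * i" using D(2) i(1) by (simp add: prod.remove mult.commute)
    then show ?thesis using subgroup_nmult[OF S(1) i(2)] by (simp add: mult_nmult)
  qed
  moreover have "\<Prod>D > 0" using D by (intro prod_pos) auto
  ultimately show thesis using that by blast
qed

lemma countable_open_type_zero:
  assumes cpt: "compact (UNIV :: 'a::{topological_ab_group_add, t2_space} set)"
    and base: "\<And>V :: 'a set. open V \<Longrightarrow> 0 \<in> V \<Longrightarrow> \<exists>H. open_subgroup H \<and> H \<subseteq> V"
    and sep: "dense_subgroup_separable TYPE('a)"
  shows "countable_open_type {0 :: 'a}"
proof -
  obtain \<I> :: "'a set set" where I: "\<And>M. M \<in> \<I> \<Longrightarrow> maximal_open_subgroup M" "independent_subgroups \<I>"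
    "\<And>M. maximal_open_subgroup M \<Longrightarrow> \<Inter>\<I> \<subseteq> M"
    using maximal_independent_family by metis
  have "countable \<I>" using independent_family_countable[OF cpt base sep I(1,2)] by blast
  have "countable_open_type (range (nmult p :: 'a \<Rightarrow> 'a))" if p: "prime p" for p
  proof -
    have "\<Inter>\<I> \<subseteq> range (nmult p)"
    proof
      fix x assume x: "x \<in> \<Inter>\<I>"
      show "x \<in> range (nmult p)"
      proof (rule ccontr)
        assume "x \<notin> range (nmult p)"
        then obtain M where "maximal_open_subgroup M" "x \<notin> M"
          using maximal_open_subgroup_avoiding[OF cpt base p] by blast
        then show False using I(3) x by blast
      qed
    qed
    then show ?thesis
      using \<open>countable \<I>\<close> I(1) unfolding countable_open_type_def maximal_open_subgroup_def by blast
  qed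
  then have "countable_open_type (range (nmult n :: 'a \<Rightarrow> 'a))" if "n > 0" for n
    using countable_open_type_nmult[OF cpt base _ that] by blast
  then obtain \<U> :: "nat \<Rightarrow> 'a set set" where U: "\<And>n. n > 0 \<Longrightarrow> countable (\<U> n)"
    "\<And>n U. n > 0 \<Longrightarrow> U \<in> \<U> n \<Longrightarrow> open_subgroup U" "\<And>n. n > 0 \<Longrightarrow> \<Inter>(\<U> n) \<subseteq> range (nmult n)"
    unfolding countable_open_type_def by metis
  let ?U = "\<Union>n\<in>{0<..}. \<U> n"
  have "x = 0" if x: "x \<in> \<Inter>?U" for x
  proof (rule ccontr)
    assume "x \<noteq> 0"
    then obtain H where H: "open_subgroup H" "x \<notin> H" using base[of "- {x}"] by auto
    obtain n where n: "n > 0" "range (nmult n) \<subseteq> H"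
      using open_subgroup_contains_multiples[OF cpt H(1)] by blast
    then have "x \<in> \<Inter>(\<U> n)" using x by blast
    then show False using U(3)[OF n(1)] n(2) H(2) by blast
  qed
  moreover have "countable ?U" using U(1) by (intro countable_UN) auto
  moreover have "\<forall>U\<in>?U. open_subgroup U" using U(2) by auto
  ultimately show ?thesis unfolding countable_open_type_def by (intro exI[of _ ?U]) blast
qed

section \<open>Metrizability\<close>

text \<open>
  By compactness the finite intersections of the given subgroups form a neighbourhood base at \<open>0\<close>,
  and each of them has only finitely many cosets.
\<close>

lemma second_countable_if_countable_open_type:
  assumes cpt: "compact (UNIV :: 'a::{topological_ab_group_add, t2_space} set)"
    and zero: "countable_open_type {0 :: 'a}"
  shows "second_countable (euclidean :: 'a topology)"
proof -
  obtain \<U> :: "'a set set" where U: "countable \<U>" "\<And>U. U \<in> \<U> \<Longrightarrow> open_subgroup U" "\<Inter>\<U> \<subseteq> {0}"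
    using countable_open_typeE[OF zero] by metis
  define Fs where "Fs = {\<F>. finite \<F> \<and> \<F> \<subseteq> \<U>}"
  define \<B> where "\<B> = (\<Union>\<F>\<in>Fs. range (\<lambda>x. (\<lambda>y. y - x) -` \<Inter>\<F>))"
  have os: "open_subgroup (\<Inter>\<F>)" if "\<F> \<in> Fs" for \<F>
    using that by (intro open_subgroup_Inter U(2)) (auto simp: Fs_def)
  have "countable \<B>"
    unfolding \<B>_def
    using U(1) open_subgroup_finite_cosets[OF cpt os]
    by (intro countable_UN) (auto simp: Fs_def countable_Collect_finite_subset intro: countable_finite)
  moreover have "open V" if "V \<in> \<B>" for V
    using that os unfolding \<B>_def open_subgroup_def by (auto intro: open_translate)
  moreover have "\<exists>B\<in>\<B>. x \<in> B \<and> B \<subseteq> V" if V: "open V" "x \<in> V" for x V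
  proof -
    have "open ((\<lambda>u. x + u) -` V)"
      using V by (intro open_vimage) (auto intro!: continuous_intros)
    moreover have "\<Inter>\<U> \<subseteq> (\<lambda>u. x + u) -` V" using U(3) V(2) by auto
    ultimately obtain \<F> where F: "finite \<F>" "\<F> \<subseteq> \<U>" "\<Inter>\<F> \<subseteq> (\<lambda>u. x + u) -` V"
      using finite_Inter_subset_open[OF cpt] U(2) open_subgroup_closed by metis
    then have "\<F> \<in> Fs" by (simp add: Fs_def)
    have "0 \<in> \<Inter>\<F>" using os[OF \<open>\<F> \<in> Fs\<close>] subgroup_zero by (auto simp: open_subgroup_def)
    moreover have "y \<in> V" if "y - x \<in> \<Inter>\<F>" for y using subsetD[OF F(3) that] by simp
    ultimately have "x \<in> (\<lambda>y. y - x) -` \<Inter>\<F>" "(\<lambda>y. y - x) -` \<Inter>\<F> \<subseteq> V" by auto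
    then show ?thesis unfolding \<B>_def using \<open>\<F> \<in> Fs\<close> by blast
  qed
  ultimately show ?thesis unfolding second_countable_def by (intro exI[of _ \<B>]) auto
qed

text \<open>
  An element is determined by its cosets modulo the given subgroups, so \<open>G\<close> maps injectively, and by
  compactness homeomorphically onto its image, into a countable product of discrete spaces.
\<close>

lemma metrizable_if_countable_open_type:
  assumes cpt: "compact (UNIV :: 'a::{topological_ab_group_add, t2_space} set)"
    and zero: "countable_open_type {0 :: 'a}"
  shows "metrizable_space (euclidean :: 'a topology)"
proof -
  obtain \<U> :: "'a set set" where U: "countable \<U>" "\<And>U. U \<in> \<U> \<Longrightarrow> open_subgroup U" "\<Inter>\<U> \<subseteq> {0}"
    using countable_open_typeE[OF zero] by metis
  define f where "f = (\<lambda>x::'a. \<lambda>U\<in>\<U>. (\<lambda>y. y - x) -` U)"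
  define P where "P = product_topology (\<lambda>_. discrete_topology (UNIV :: 'a set set)) \<U>"
  have "metrizable_space P"
    unfolding P_def metrizable_space_product_topology using U(1)
    by (auto intro: countable_subset[of _ \<U>])
  have "Hausdorff_space P"
    unfolding P_def by (simp add: Hausdorff_space_product_topology)
  have eqI: "(\<lambda>z. z - y) -` U = (\<lambda>z. z - x) -` U" if "U \<in> \<U>" "y - x \<in> U" for U x y
  proof -
    have S: "additive_subgroup_set U" using U(2)[OF that(1)] by (simp add: open_subgroup_def)
    show ?thesis
      using subgroup_add[OF S _ that(2)] subgroup_diff[OF S _ that(2)] by fastforce
  qed
  have "open {x. (\<lambda>y. y - x) -` U \<in> S}" if "U \<in> \<U>" for U S
  proof (subst open_subopen, intro ballI)
    fix x assume x: "x \<in> {x. (\<lambda>y. y - x) -` U \<in> S}"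
    have "open U" "0 \<in> U" using U(2)[OF that] subgroup_zero by (auto simp: open_subgroup_def)
    then show "\<exists>T. open T \<and> x \<in> T \<and> T \<subseteq> {x. (\<lambda>y. y - x) -` U \<in> S}"
      using x eqI[OF that] by (intro exI[of _ "(\<lambda>y. y - x) -` U"]) (auto intro: open_translate)
  qed
  then have cont: "continuous_map euclidean P f"
    unfolding P_def continuous_map_componentwise f_def
    by (auto simp: continuous_map_def)
  have inj: "inj f"
  proof (rule injI)
    fix x y assume "f x = f y"
    have "x - y \<in> U" if "U \<in> \<U>" for U
    proof -
      have "(\<lambda>z. z - x) -` U = (\<lambda>z. z - y) -` U"
        using fun_cong[OF \<open>f x = f y\<close>, of U] that by (simp add: f_def)
      moreover have "x \<in> (\<lambda>z. z - x) -` U"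
        using U(2)[OF that] subgroup_zero by (auto simp: open_subgroup_def)
      ultimately show ?thesis by auto
    qed
    then have "x - y \<in> {0}" using U(3) by blast
    then show "x = y" by simp
  qed
  have "closed_map euclidean P f"
    using T1_Spaces.continuous_imp_closed_map[OF cont] cpt \<open>Hausdorff_space P\<close> by (auto simp: compact_space_def)
  then have "embedding_map euclidean P f"
    using injective_closed_imp_embedding_map[OF cont] inj by simp
  then have "(euclidean :: 'a topology) homeomorphic_space subtopology P (range f)"
    using embedding_map_imp_homeomorphic_space[of euclidean P f] by simp
  then show ?thesis
    using homeomorphic_metrizable_space metrizable_space_subtopology[OF \<open>metrizable_space P\<close>] by blast
qed

theorem theorem3p11:
  assumes "compact (UNIV :: 'a::{topological_ab_group_add, t2_space} set)"
    and "totally_disconnected_space (euclidean :: 'a topology)"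
    and "dense_subgroup_separable TYPE('a)"
  shows "metrizable_space (euclidean :: 'a topology) \<and> dense_separable (euclidean :: 'a topology)"
proof
  have zero: "countable_open_type {0 :: 'a}"
    using countable_open_type_zero[OF assms(1) _ assms(3)] open_subgroup_base[OF assms(1,2)] by metis
  show "metrizable_space (euclidean :: 'a topology)"
    using metrizable_if_countable_open_type[OF assms(1) zero] .
  have "second_countable (euclidean :: 'a topology)"
    using second_countable_if_countable_open_type[OF assms(1) zero] .
  then show "dense_separable (euclidean :: 'a topology)"
    unfolding dense_separable_def
    using second_countable_subtopology second_countable_imp_separable_space by blast
qed

end
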